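(* Let $n$ be an even positive integer and let $j$ be a positive integer with $j \equiv 2 \pmod 4$ and $\gcd\left(\tfrac12 j, \tfrac12 n\right)=1$. Then $$\sum_{k=1}^{\frac12 n-1} \frac{\sin\left(\frac{(j-1)k\pi}{n}\right)\sin\left(\frac{(j+1)k\pi}{n}\right)}{\sin^2\left(\frac{k\pi}{n}\right)\sin^2\left(\frac{jk\pi}{n}\right)}=\frac{n^2-4}{12}.$$
   Context: An empty sum (when $n=2$) equals $0$. *)

theory Defs
  imports Complex_Main
begin

end

theory Submission
  imports Defs
begin

text \<open>
  Since \<open>sin ((j - 1) x) sin ((j + 1) x) = sin\<^sup>2 (j x) - sin\<^sup>2 x\<close>, the summand is
  \<open>1 / sin\<^sup>2 x - 1 / sin\<^sup>2 (j x)\<close>. With \<open>n = 2 m\<close> and \<open>j = 2 i\<close> the second part sums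
  \<open>1 / sin\<^sup>2 (i k \<pi> / m)\<close>, which is \<open>(m\<^sup>2 - 1) / 3\<close> for \<open>i\<close> coprime to \<open>m\<close>; the first part is twice
  that value, because \<open>4 / sin\<^sup>2 (2 x) = 1 / sin\<^sup>2 x + 1 / cos\<^sup>2 x\<close>.

  To evaluate the sum of \<open>1 / sin\<^sup>2\<close>, let \<open>g d\<close> be the sum over \<open>0 < k < m\<close> of
  \<open>cos (2 d x\<^sub>k) / sin\<^sup>2 x\<^sub>k\<close> where \<open>x\<^sub>k = i k \<pi> / m\<close>. Its second difference is constantly \<open>4\<close> for
  \<open>0 < d < m\<close>, so \<open>g d = g 0 - 2 d (m - d)\<close>, while the sum of \<open>g\<close> over a period vanishes. This
  determines \<open>g 0\<close>.
\<close>

lemma sin_rational_pi_nonzero: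
  fixes a m :: nat
  assumes "m > 0" and "\<not> m dvd a"
  shows "sin (real a * pi / real m) \<noteq> 0"
proof
  assume "sin (real a * pi / real m) = 0"
  then obtain z :: int where "real a * pi / real m = of_int z * pi"
    by (auto simp: sin_zero_iff_int2)
  then have "real a = of_int z * real m"
    using \<open>m > 0\<close> by (simp add: field_simps)
  then have "real_of_int (int a) = real_of_int (z * int m)"
    by simp
  then have "int a = z * int m"
    by (simp only: of_int_eq_iff)
  then have "int m dvd int a"
    by simp
  with \<open>\<not> m dvd a\<close> show False
    by simp
qed

text \<open>Multiplying by \<open>2 * sin x\<close> makes the sum telescope; after \<open>m\<close>
  terms the boundary values cancel, since \<open>(2 * m - 1) * x\<close> differs from
  \<open>- x\<close> by a multiple of \<open>2 * pi\<close>.\<close>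

lemma sum_cos_multiples_period_zero:
  fixes a m :: nat
  assumes "m > 0" and "\<not> m dvd a"
  shows "(\<Sum>d<m. cos (2 * real d * (real a * pi / real m))) = 0"
proof -
  define x where "x = real a * pi / real m"
  have partial: "2 * sin x * (\<Sum>d<N. cos (2 * real d * x)) = sin ((2 * real N - 1) * x) + sin x" for N
  proof (induction N)
    case (Suc N)
    have "sin ((2 * real N + 1) * x) - sin ((2 * real N - 1) * x) = 2 * sin x * cos (2 * real N * x)"
      using sin_diff_sin[of "(2 * real N + 1) * x" "(2 * real N - 1) * x"]
      by (simp add: algebra_simps)
    with Suc show ?case
      by (simp add: algebra_simps)
  qed simp
  have "(2 * real m - 1) * x = - x + real (2 * a) * pi"
    using \<open>m > 0\<close> by (simp add: x_def field_simps)
  then have "sin ((2 * real m - 1) * x) = - sin x"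
    by (simp only: sin_add sin_npi cos_npi) simp
  with partial[of m] sin_rational_pi_nonzero[OF assms] show ?thesis
    by (simp add: x_def)
qed

text \<open>\<open>N\<close> is kept apart from \<open>m\<close> so that it stays fixed in the
  induction; the use below has \<open>N = m\<close>.\<close>

lemma sum_diff_product:
  "(\<Sum>d<m. real d * (real N - real d)) = real m * (real m - 1) * (3 * real N - 2 * real m + 1) / 6"
  by (induction m) (simp_all add: field_simps)

text \<open>The factor \<open>i\<close> is carried along instead of being removed by permuting
  residues; coprimality enters through \<open>not_dvd\<close>.\<close>

lemma sum_inverse_sin_squared:
  fixes i m :: nat
  assumes "m > 0" and "coprime i m"
  shows "(\<Sum>k = 1..<m. 1 / (sin (real i * real k * pi / real m))\<^sup>2) = ((real m)\<^sup>2 - 1) / 3"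
proof -
  define x where "x = (\<lambda>k::nat. real (i * k) * pi / real m)"
  define g where "g = (\<lambda>d::nat. \<Sum>k = 1..<m. cos (2 * real d * x k) / (sin (x k))\<^sup>2)"
  have not_dvd: "\<not> m dvd i * k" if "k \<in> {1..<m}" for k
    using that \<open>coprime i m\<close> by (auto simp: coprime_commute coprime_dvd_mult_right_iff dest: dvd_imp_le)
  have sin_nz: "sin (x k) \<noteq> 0" if "k \<in> {1..<m}" for k
    unfolding x_def using sin_rational_pi_nonzero[OF \<open>m > 0\<close> not_dvd[OF that]] .
  \<comment> \<open>The term is symmetric in \<open>d\<close> and \<open>k\<close>, so this is a
    full-period sum lacking its \<open>k = 0\<close> term, which is 1.\<close>
  have sum_cos: "(\<Sum>k = 1..<m. cos (2 * real d * x k)) = -1" if "d \<in> {1..<m}" for d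
  proof -
    have "0 = (\<Sum>k<m. cos (2 * real k * (real (i * d) * pi / real m)))"
      using sum_cos_multiples_period_zero[OF \<open>m > 0\<close> not_dvd[OF that]] by simp
    also have "\<dots> = (\<Sum>k<m. cos (2 * real d * x k))"
      by (simp add: x_def mult_ac)
    also have "\<dots> = 1 + (\<Sum>k = 1..<m. cos (2 * real d * x k))"
      using \<open>m > 0\<close> by (simp add: lessThan_atLeast0 sum.atLeast_Suc_lessThan x_def)
    finally show ?thesis by simp
  qed
  \<comment> \<open>The numerators combine to a multiple of \<open>(sin (x k))\<^sup>2\<close>,
    which cancels the denominator. The bound on \<open>d\<close> puts the middle index
    \<open>Suc d\<close> in the range of \<open>sum_cos\<close>.\<close>
  have second_diff: "g (Suc (Suc d)) - 2 * g (Suc d) + g d = 4" if "Suc (Suc d) \<le> m" for d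
  proof -
    have "g (Suc (Suc d)) - 2 * g (Suc d) + g d =
        (\<Sum>k = 1..<m. cos (2 * real (Suc (Suc d)) * x k) / (sin (x k))\<^sup>2
           - 2 * (cos (2 * real (Suc d) * x k) / (sin (x k))\<^sup>2) + cos (2 * real d * x k) / (sin (x k))\<^sup>2)"
      by (simp only: g_def sum.distrib sum_subtractf sum_distrib_left)
    also have "\<dots> = (\<Sum>k = 1..<m. - 4 * cos (2 * real (Suc d) * x k))"
    proof (rule sum.cong[OF refl])
      fix k assume k: "k \<in> {1..<m}"
      define y where "y = 2 * real (Suc d) * x k"
      have e: "2 * real (Suc (Suc d)) * x k = y + 2 * x k" "2 * real d * x k = y - 2 * x k"
        by (simp_all add: y_def algebra_simps)
      have "cos (y + 2 * x k) - 2 * cos y + cos (y - 2 * x k) = - 4 * cos y * (sin (x k))\<^sup>2"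
        unfolding cos_add cos_diff cos_double_sin by (simp add: algebra_simps)
      then show "cos (2 * real (Suc (Suc d)) * x k) / (sin (x k))\<^sup>2
           - 2 * (cos (2 * real (Suc d) * x k) / (sin (x k))\<^sup>2) + cos (2 * real d * x k) / (sin (x k))\<^sup>2
           = - 4 * cos (2 * real (Suc d) * x k)"
        unfolding e y_def[symmetric] using sin_nz[OF k] by (simp add: field_simps)
    qed
    also have "\<dots> = 4"
      using sum_cos[of "Suc d"] that unfolding sum_distrib_left[symmetric] by simp
    finally show ?thesis .
  qed
  have first_diff: "g 1 - g 0 = - 2 * (real m - 1)"
  proof -
    have "g 1 - g 0 = (\<Sum>k = 1..<m. cos (2 * x k) / (sin (x k))\<^sup>2 - 1 / (sin (x k))\<^sup>2)"
      by (simp add: g_def sum_subtractf)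
    also have "\<dots> = (\<Sum>k = 1..<m. - 2)"
      by (intro sum.cong refl) (use sin_nz in \<open>simp add: cos_double_sin diff_divide_distrib\<close>)
    finally show ?thesis
      using \<open>m > 0\<close> by (simp add: of_nat_diff)
  qed
  \<comment> \<open>Two consecutive values are carried because the recurrence has order two.\<close>
  have g_eq: "g d = g 0 - 2 * (real d * (real m - real d)) \<and>
      g (Suc d) = g 0 - 2 * (real (Suc d) * (real m - real (Suc d)))" if "Suc d \<le> m" for d
    using that
  proof (induction d)
    case 0
    then show ?case using first_diff by simp
  next
    case (Suc d)
    then show ?case using second_diff[of d] by (simp add: algebra_simps)
  qed
  \<comment> \<open>Exchanging the sums puts a vanishing full-period cosine sum in each
    numerator.\<close>
  have "(\<Sum>d<m. g d) = (\<Sum>k = 1..<m. (\<Sum>d<m. cos (2 * real d * x k)) / (sin (x k))\<^sup>2)"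
    unfolding g_def by (subst sum.swap) (simp add: sum_divide_distrib)
  also have "\<dots> = 0"
    by (rule sum.neutral) (use sum_cos_multiples_period_zero[OF \<open>m > 0\<close> not_dvd] in \<open>simp add: x_def\<close>)
  finally have "(\<Sum>d<m. g 0 - 2 * (real d * (real m - real d))) = 0"
    using g_eq by (metis (no_types, lifting) Suc_leI lessThan_iff sum.cong)
  then have "real m * g 0 = 2 * (real m * (real m - 1) * (real m + 1) / 6)"
    by (simp add: sum_subtractf sum_diff_product flip: sum_distrib_left)
  then have "real m * g 0 = real m * (((real m)\<^sup>2 - 1) / 3)"
    by (simp add: field_simps power2_eq_square)
  then have "g 0 = ((real m)\<^sup>2 - 1) / 3"
    using \<open>m > 0\<close> by (simp only: mult_cancel_left) simp
  then show ?thesis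
    by (simp add: g_def x_def)
qed

text \<open>Replacing \<open>k\<close> by \<open>m - k\<close> swaps sine and cosine of
  \<open>y k\<close>, so both parts of the double-angle identity have the same sum.\<close>

lemma sum_inverse_sin_squared_half_period:
  fixes m :: nat
  assumes "m > 0"
  shows "(\<Sum>k = 1..<m. 1 / (sin (real k * pi / (2 * real m)))\<^sup>2) = 2 * ((real m)\<^sup>2 - 1) / 3"
proof -
  define y where "y = (\<lambda>k::nat. real k * pi / (2 * real m))"
  have double: "1 / (sin (real k * pi / real m))\<^sup>2 = (1 / (sin (y k))\<^sup>2 + 1 / (sin (y (m - k)))\<^sup>2) / 4"
    if k: "k \<in> {1..<m}" for k
  proof -
    have "y (m - k) = pi / 2 - y k"
      using k by (simp add: y_def of_nat_diff field_simps)
    then have c: "sin (y (m - k)) = cos (y k)"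
      by (simp add: sin_diff)
    have "sin (2 * y k) = 2 * sin (y k) * cos (y k)"
      by (rule sin_double)
    moreover have d: "2 * y k = real k * pi / real m"
      by (simp add: y_def)
    moreover have "sin (real k * pi / real m) \<noteq> 0"
      using k by (intro sin_rational_pi_nonzero) (auto dest: dvd_imp_le)
    ultimately have nz: "sin (y k) \<noteq> 0" "cos (y k) \<noteq> 0"
      by auto
    have "(1 / (sin (y k))\<^sup>2 + 1 / (cos (y k))\<^sup>2) / 4
        = ((sin (y k))\<^sup>2 + (cos (y k))\<^sup>2) / (2 * sin (y k) * cos (y k))\<^sup>2"
      using nz by (simp add: field_simps)
    then show ?thesis
      unfolding c d[symmetric] sin_double by simp
  qed
  have "((real m)\<^sup>2 - 1) / 3 = (\<Sum>k = 1..<m. 1 / (sin (real k * pi / real m))\<^sup>2)"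
    using sum_inverse_sin_squared[OF assms, of 1] by simp
  also have "\<dots> = ((\<Sum>k = 1..<m. 1 / (sin (y k))\<^sup>2) + (\<Sum>k = 1..<m. 1 / (sin (y (m - k)))\<^sup>2)) / 4"
    by (simp add: double sum.distrib flip: sum_divide_distrib)
  also have "(\<Sum>k = 1..<m. 1 / (sin (y (m - k)))\<^sup>2) = (\<Sum>k = 1..<m. 1 / (sin (y k))\<^sup>2)"
    by (rule sum.reindex_bij_witness[where i = "\<lambda>k. m - k" and j = "\<lambda>k. m - k"]) auto
  finally show ?thesis
    by (simp add: y_def)
qed

theorem theorem2p1:
  fixes n j :: nat
  assumes "n > 0" and "even n"
    and "j > 0" and "j mod 4 = 2"
    and "gcd (j div 2) (n div 2) = 1"
  shows "(\<Sum>k = 1..n div 2 - 1.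
            (sin ((real j - 1) * real k * pi / real n) * sin ((real j + 1) * real k * pi / real n))
            / ((sin (real k * pi / real n))\<^sup>2 * (sin (real j * real k * pi / real n))\<^sup>2))
         = ((real n)\<^sup>2 - 4) / 12"
proof -
  obtain m where n: "n = 2 * m"
    using \<open>even n\<close> by auto
  have "even j"
    using \<open>j mod 4 = 2\<close> by presburger
  then obtain i where j: "j = 2 * i"
    by auto
  have m: "m > 0" and cop: "coprime i m"
    using assms n j by (simp_all add: coprime_iff_gcd_eq_1)
  have range: "{1..n div 2 - 1} = {1..<m}"
    using n m by auto
  have summand: "(sin ((real j - 1) * real k * pi / real n) * sin ((real j + 1) * real k * pi / real n))
            / ((sin (real k * pi / real n))\<^sup>2 * (sin (real j * real k * pi / real n))\<^sup>2)
      = 1 / (sin (real k * pi / (2 * real m)))\<^sup>2 - 1 / (sin (real i * real k * pi / real m))\<^sup>2"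
    if k: "k \<in> {1..<m}" for k
  proof -
    \<comment> \<open>With \<open>n = 2 * m\<close> and \<open>j = 2 * i\<close>, these are the
      angles \<open>k * pi / n\<close> and \<open>j * k * pi / n\<close> in the form used by the two
      sum lemmas.\<close>
    define u where "u = real k * pi / (2 * real m)"
    define v where "v = real i * real k * pi / real m"
    have args: "(real j - 1) * real k * pi / real n = v - u" "(real j + 1) * real k * pi / real n = v + u"
        "real k * pi / real n = u" "real j * real k * pi / real n = v"
      using m by (simp_all add: u_def v_def n j field_simps)
    have "\<not> 2 * m dvd k"
      using k by (auto dest: dvd_imp_le)
    then have u_nz: "sin u \<noteq> 0"
      using sin_rational_pi_nonzero[of "2 * m" k] m by (simp add: u_def)
    have "\<not> m dvd i * k"
      using k cop by (auto simp: coprime_commute coprime_dvd_mult_right_iff dest: dvd_imp_le)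
    then have v_nz: "sin v \<noteq> 0"
      using sin_rational_pi_nonzero[OF m, of "i * k"] by (simp add: v_def)
    have "sin (v - u) * sin (v + u) = (sin v)\<^sup>2 * (cos u)\<^sup>2 - (cos v)\<^sup>2 * (sin u)\<^sup>2"
      by (simp add: sin_add sin_diff algebra_simps power2_eq_square)
    also have "\<dots> = (sin v)\<^sup>2 - (sin u)\<^sup>2"
      by (simp add: cos_squared_eq algebra_simps)
    finally show ?thesis
      unfolding args u_def[symmetric] v_def[symmetric] using u_nz v_nz by (simp add: field_simps)
  qed
  \<comment> \<open>The difference of the two sums is \<open>(m\<^sup>2 - 1) / 3\<close>, and
    \<open>4 * m\<^sup>2 = n\<^sup>2\<close>.\<close>
  have "(\<Sum>k = 1..<m. 1 / (sin (real k * pi / (2 * real m)))\<^sup>2 - 1 / (sin (real i * real k * pi / real m))\<^sup>2)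
      = ((real n)\<^sup>2 - 4) / 12"
    unfolding sum_subtractf sum_inverse_sin_squared[OF m cop] sum_inverse_sin_squared_half_period[OF m]
    by (simp add: n field_simps)
  then show ?thesis
    unfolding range by (simp only: summand cong: sum.cong)
qed

end
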